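(* Let $X$ be a Baire space and let $\kappa=\min\{|\mathcal{G}|:\mathcal{G}\text{ is a Kuratowski partition of }X\}$, where $\kappa$ is a regular cardinal. Let $\mathcal{F}=\{F_\alpha:\alpha<\kappa\}$ be a Kuratowski partition of $X$ of cardinality $\kappa$, and let $I_{\mathcal{F}}$ be the $K$-ideal associated with $\mathcal{F}$. If the space $X(I_{\mathcal{F}})$ is complete, then there is an open set $U\subseteq X$ such that the ideal $I_{\mathcal{F}\cap U}$ is a maximal ideal on $\kappa$.
   Context: A set $A\subseteq X$ has the Baire property if $A=V\triangle M$ for some open $V$ and meager $M$. A Kuratowski partition of a Baire space $X$ is a partition $\mathcal{F}$ of $X$ into meager sets such that $\bigcup\mathcal{F}'$ has the Baire property for every $\mathcal{F}'\subseteq\mathcal{F}$. For a Kuratowski partition $\mathcal{F}=\{F_\alpha:\alpha<\kappa\}$ its $K$-ideal is $I_{\mathcal{F}}=\{A\subseteq\kappa:\bigcup_{\alpha\in A}F_\alpha\text{ is meager in }X\}$. For an open set $U\subseteq X$ (a Baire subspace), $\mathcal{F}\cap U=\{F_\alpha\cap U:\alpha<\kappa\}$ is a Kuratowski partition of $U$, and $I_{\mathcal{F}\cap U}=\{A\subseteq\kappa:\bigcup_{\alpha\in A}(F_\alpha\cap U)\text{ is meager in }U\}$. For an ideal $I$ on $\kappa$, write $I^+=P(\kappa)\setminus I$ and $X(I)=\{x\in (I^+)^\omega:\bigcap_{n\in\omega}x(n)\neq\emptyset\text{ and for all }n\in\omega,\ \bigcap_{m<n}x(m)\notin I\}$, regarded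 as a subspace of the complete metric space $(I^+)^\omega$ (product of countably many copies of the discrete space $I^+$, with the standard complete product metric); "complete" means complete as a metric subspace. An ideal $I$ on $\kappa$ is maximal if it is proper and for every $A\subseteq\kappa$ either $A\in I$ or $\kappa\setminus A\in I$. *)

theory Defs
  imports "HOL-Analysis.Analysis"
begin

unbundle cardinal_syntax

definition Baire_space :: "'a topology \<Rightarrow> bool" where
  "Baire_space X \<longleftrightarrow>
     (\<forall>G :: nat \<Rightarrow> 'a set. (\<forall>n. openin X (G n) \<and> X closure_of (G n) = topspace X)
        \<longrightarrow> X closure_of (\<Inter>n. G n) = topspace X)"

definition nowhere_dense_in :: "'a topology \<Rightarrow> 'a set \<Rightarrow> bool" where
  "nowhere_dense_in X S \<longleftrightarrow> S \<subseteq> topspace X \<and> X interior_of (X closure_of S) = {}"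

definition meager_in :: "'a topology \<Rightarrow> 'a set \<Rightarrow> bool" where
  "meager_in X S \<longleftrightarrow> (\<exists>N :: nat \<Rightarrow> 'a set. (\<forall>n. nowhere_dense_in X (N n)) \<and> S = (\<Union>n. N n))"

definition Baire_property :: "'a topology \<Rightarrow> 'a set \<Rightarrow> bool" where
  "Baire_property X A \<longleftrightarrow> (\<exists>V M. openin X V \<and> meager_in X M \<and> A = sym_diff V M)"

definition Kuratowski_partition :: "'a topology \<Rightarrow> 'a set set \<Rightarrow> bool" where
  "Kuratowski_partition X \<F> \<longleftrightarrow>
     partition_on (topspace X) \<F> \<and> (\<forall>S\<in>\<F>. meager_in X S) \<and>
     (\<forall>\<F>'. \<F>' \<subseteq> \<F> \<longrightarrow> Baire_property X (\<Union>\<F>'))"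

text \<open>Cardinals are represented by cardinal orders \<^term>\<open>k\<close>; the ordinals below the cardinal
  are the elements of \<^term>\<open>Field k\<close>.\<close>

definition min_Kuratowski_card :: "'a topology \<Rightarrow> 'k rel \<Rightarrow> bool" where
  "min_Kuratowski_card X k \<longleftrightarrow> Card_order k \<and>
     (\<exists>\<G>. Kuratowski_partition X \<G> \<and> |\<G>| =o k) \<and>
     (\<forall>\<G>. Kuratowski_partition X \<G> \<longrightarrow> k \<le>o |\<G>| )"

definition K_ideal :: "'a topology \<Rightarrow> 'k set \<Rightarrow> ('k \<Rightarrow> 'a set) \<Rightarrow> 'k set set" where
  "K_ideal X K F = {A. A \<subseteq> K \<and> meager_in X (\<Union>\<alpha>\<in>A. F \<alpha>)}"

definition ideal_on :: "'k set \<Rightarrow> 'k set set \<Rightarrow> bool" where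
  "ideal_on K I \<longleftrightarrow> I \<subseteq> Pow K \<and> {} \<in> I \<and>
     (\<forall>A B. A \<in> I \<and> B \<subseteq> A \<longrightarrow> B \<in> I) \<and> (\<forall>A B. A \<in> I \<and> B \<in> I \<longrightarrow> A \<union> B \<in> I)"

definition maximal_ideal_on :: "'k set \<Rightarrow> 'k set set \<Rightarrow> bool" where
  "maximal_ideal_on K I \<longleftrightarrow> ideal_on K I \<and> K \<notin> I \<and> (\<forall>A\<subseteq>K. A \<in> I \<or> K - A \<in> I)"

definition positive_sets :: "'k set \<Rightarrow> 'k set set \<Rightarrow> 'k set set" where
  "positive_sets K I = Pow K - I"

text \<open>The intersection over the empty index set \<open>m < 0\<close> is \<^term>\<open>K\<close>.\<close>

definition ideal_space :: "'k set \<Rightarrow> 'k set set \<Rightarrow> (nat \<Rightarrow> 'k set) set" where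
  "ideal_space K I =
     {x \<in> UNIV \<rightarrow> positive_sets K I. (\<Inter>n. x n) \<noteq> {} \<and> (\<forall>n. K \<inter> (\<Inter>m<n. x m) \<notin> I)}"

text \<open>The usual metric on a countable power of a discrete space. The lemmas below check that it is
  complete and induces the product topology on \<open>S\<^sup>\<omega>\<close>.\<close>

definition seq_dist :: "(nat \<Rightarrow> 'b) \<Rightarrow> (nat \<Rightarrow> 'b) \<Rightarrow> real" where
  "seq_dist x y = (if x = y then 0 else (1/2) ^ (LEAST n. x n \<noteq> y n))"

lemma seq_dist_less_iff: "seq_dist x y < (1/2) ^ n \<longleftrightarrow> (\<forall>m\<le>n. x m = y m)"
proof (cases "x = y")
  case True
  then show ?thesis by (simp add: seq_dist_def)
next
  case False
  then obtain k where "x k \<noteq> y k" by blast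
  define N where "N = (LEAST n. x n \<noteq> y n)"
  have N: "x N \<noteq> y N" unfolding N_def by (rule LeastI) fact
  have less: "x m = y m" if "m < N" for m
    using not_less_Least that unfolding N_def by blast
  have "seq_dist x y < (1/2) ^ n \<longleftrightarrow> n < N"
    using False by (simp add: seq_dist_def N_def[symmetric] power_strict_decreasing_iff)
  also have "\<dots> \<longleftrightarrow> (\<forall>m\<le>n. x m = y m)"
    by (meson N less le_less_trans not_le)
  finally show ?thesis .
qed

lemma seq_dist_nonneg: "0 \<le> seq_dist x y"
  by (simp add: seq_dist_def)

lemma seq_dist_commute: "seq_dist x y = seq_dist y x"
  by (simp add: seq_dist_def eq_commute)

lemma seq_dist_eq_0_iff: "seq_dist x y = 0 \<longleftrightarrow> x = y"
  by (simp add: seq_dist_def)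

lemma seq_dist_ultrametric: "seq_dist x z \<le> max (seq_dist x y) (seq_dist y z)"
proof (cases "x = z")
  case True
  then show ?thesis by (simp add: seq_dist_def le_max_iff_disj)
next
  case False
  define N where "N = (LEAST n. x n \<noteq> z n)"
  have "x N \<noteq> z N" unfolding N_def by (rule LeastI_ex) (use False in blast)
  then have "\<not> (\<forall>m\<le>N. x m = y m) \<or> \<not> (\<forall>m\<le>N. y m = z m)" by force
  then have "(1/2) ^ N \<le> seq_dist x y \<or> (1/2) ^ N \<le> seq_dist y z"
    unfolding seq_dist_less_iff[symmetric] by auto
  moreover have "seq_dist x z = (1/2) ^ N"
    using False by (simp add: seq_dist_def N_def)
  ultimately show ?thesis by auto
qed

lemma Metric_space_seq_dist: "Metric_space S seq_dist"
proof
  fix x y z :: "nat \<Rightarrow> 'a"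
  show "seq_dist x z \<le> seq_dist x y + seq_dist y z"
    using seq_dist_ultrametric[of x z y] seq_dist_nonneg[of x y] seq_dist_nonneg[of y z] by linarith
qed (simp_all add: seq_dist_nonneg seq_dist_commute seq_dist_eq_0_iff)

lemma half_power_less:
  assumes "0 < (e::real)"
  obtains n :: nat where "(1/2) ^ n < e"
  using real_arch_pow_inv[of e "1/2"] assms by auto

lemma mcomplete_seq_dist: "Metric_space.mcomplete (UNIV \<rightarrow> S) (seq_dist :: (nat \<Rightarrow> 'b) \<Rightarrow> _)"
proof -
  interpret Metric_space "UNIV \<rightarrow> S" "seq_dist :: (nat \<Rightarrow> 'b) \<Rightarrow> _"
    by (rule Metric_space_seq_dist)
  show ?thesis
    unfolding mcomplete_def
  proof (intro strip)
    fix \<sigma> :: "nat \<Rightarrow> nat \<Rightarrow> 'b"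
    assume "MCauchy \<sigma>"
    then have S: "\<And>i n. \<sigma> i n \<in> S"
      and C: "\<And>e. e > 0 \<Longrightarrow> \<exists>N. \<forall>i j. N \<le> i \<longrightarrow> N \<le> j \<longrightarrow> seq_dist (\<sigma> i) (\<sigma> j) < e"
      by (auto simp: MCauchy_def)
    have "\<exists>N. \<forall>i j. N \<le> i \<longrightarrow> N \<le> j \<longrightarrow> (\<forall>m\<le>n. \<sigma> i m = \<sigma> j m)" for n
      using C[of "(1/2) ^ n"] by (simp add: seq_dist_less_iff)
    then obtain N where N: "\<And>n i j m. \<lbrakk>N n \<le> i; N n \<le> j; m \<le> n\<rbrakk> \<Longrightarrow> \<sigma> i m = \<sigma> j m"
      by metis
    define x where "x = (\<lambda>n. \<sigma> (N n) n)"
    have x: "\<sigma> i m = x m" if "N n \<le> i" "m \<le> n" for i m n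
    proof -
      have "\<sigma> i m = \<sigma> (max i (N m)) m" by (rule N[of n]) (use that in auto)
      also have "\<dots> = x m" unfolding x_def by (rule N[of m]) auto
      finally show ?thesis .
    qed
    have "limitin mtopology \<sigma> x sequentially"
      unfolding limit_metric_sequentially
    proof (intro conjI strip)
      show "x \<in> UNIV \<rightarrow> S" using S by (simp add: x_def)
      fix e :: real assume "e > 0"
      then obtain n :: nat where n: "(1/2) ^ n < e" by (rule half_power_less)
      show "\<exists>M. \<forall>i\<ge>M. \<sigma> i \<in> UNIV \<rightarrow> S \<and> seq_dist (\<sigma> i) x < e"
      proof (intro exI[of _ "N n"] strip conjI)
        fix i assume "N n \<le> i"
        then have "seq_dist (\<sigma> i) x < (1/2) ^ n" unfolding seq_dist_less_iff using x by blast
        then show "seq_dist (\<sigma> i) x < e" using n by linarith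
      qed (use S in auto)
    qed
    then show "\<exists>x. limitin mtopology \<sigma> x sequentially" by blast
  qed
qed

lemma mtopology_seq_dist:
  "Metric_space.mtopology (UNIV \<rightarrow> S) (seq_dist :: (nat \<Rightarrow> 'b) \<Rightarrow> _) =
   product_topology (\<lambda>_. discrete_topology S) UNIV"
proof -
  interpret Metric_space "UNIV \<rightarrow> S" "seq_dist :: (nat \<Rightarrow> 'b) \<Rightarrow> _"
    by (rule Metric_space_seq_dist)
  have "openin mtopology U \<longleftrightarrow> openin (product_topology (\<lambda>_. discrete_topology S) UNIV) U" for U
  proof
    assume U: "openin mtopology U"
    show "openin (product_topology (\<lambda>_. discrete_topology S) UNIV) U"
      unfolding openin_product_topology_alt
    proof
      fix x assume "x \<in> U"
      with U obtain r where r: "r > 0" "mball x r \<subseteq> U" and xS: "x \<in> UNIV \<rightarrow> S"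
        unfolding openin_mtopology by blast
      obtain n :: nat where n: "(1/2) ^ n < r" using r(1) by (rule half_power_less)
      define W where "W = (\<lambda>i. if i \<le> n then {x i} else S)"
      have "PiE UNIV W \<subseteq> mball x r"
      proof
        fix y assume y: "y \<in> PiE UNIV W"
        have "y m = x m" if "m \<le> n" for m
          using PiE_mem[OF y, of m] that by (simp add: W_def)
        then have "seq_dist x y < (1/2) ^ n" by (simp add: seq_dist_less_iff)
        moreover have "y m \<in> S" for m
          using PiE_mem[OF y, of m] xS by (auto simp: W_def Pi_iff split: if_splits)
        ultimately show "y \<in> mball x r" using n xS by (auto simp: mball_def)
      qed
      moreover have "finite {i. W i \<noteq> S}"
        by (rule finite_subset[of _ "{..n}"]) (auto simp: W_def)
      ultimately show "\<exists>W. finite {i \<in> UNIV. W i \<noteq> topspace (discrete_topology S)} \<and>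
          (\<forall>i\<in>UNIV. openin (discrete_topology S) (W i)) \<and> x \<in> PiE UNIV W \<and> PiE UNIV W \<subseteq> U"
        using r(2) xS by (intro exI[of _ W]) (auto simp: W_def Pi_iff PiE_iff)
    qed
  next
    assume U: "openin (product_topology (\<lambda>_. discrete_topology S) UNIV) U"
    show "openin mtopology U"
      unfolding openin_mtopology
    proof (intro conjI strip)
      show "U \<subseteq> UNIV \<rightarrow> S" using openin_subset[OF U] by (auto simp: PiE_iff)
      fix x assume "x \<in> U"
      with U obtain W where W: "finite {i. W i \<noteq> S}" "x \<in> PiE UNIV W" "PiE UNIV W \<subseteq> U"
        unfolding openin_product_topology_alt by auto
      obtain n where n: "\<And>i. W i \<noteq> S \<Longrightarrow> i \<le> n"
        using W(1) unfolding finite_nat_set_iff_bounded_le by auto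
      have "mball x ((1/2) ^ n) \<subseteq> PiE UNIV W"
      proof
        fix y assume "y \<in> mball x ((1/2) ^ n)"
        then have y: "\<And>m. y m \<in> S" "\<And>m. m \<le> n \<Longrightarrow> x m = y m"
          by (auto simp: mball_def seq_dist_less_iff)
        have "y m \<in> W m" for m
        proof (cases "m \<le> n")
          case True
          then show ?thesis using y(2)[of m] PiE_mem[OF W(2), of m] by simp
        next
          case False
          then show ?thesis using y(1)[of m] n by blast
        qed
        then show "y \<in> PiE UNIV W" by auto
      qed
      then show "\<exists>r>0. mball x r \<subseteq> U"
        using W(3) by (intro exI[of _ "(1/2) ^ n"]) auto
    qed
  qed
  then show ?thesis by (simp add: topology_eq)
qed

end

theory Submission
  imports Defs
begin

text \<open>Completeness of \<open>X(I)\<close> forces every decreasing sequence of \<open>I\<close>-positive sets to have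
  nonempty intersection, because such a sequence is the limit of its eventually constant truncations,
  which lie in \<open>X(I)\<close>. If every positive set could be split into two positive pieces, then
  splitting repeatedly, always keeping one piece, would give a decreasing sequence \<open>C\<close> of positive
  sets. The sets \<open>C n - \<Inter>(range C)\<close> contain the discarded pieces, so they are positive,
  but their intersection is empty. Hence some positive set \<open>A\<close> is an atom modulo \<open>I\<close>. Writing the
  union of the \<open>F \<alpha>\<close> with \<open>\<alpha> \<in> A\<close> as an open set \<open>U\<close> modulo a meager set, the
  ideal of the partition restricted to \<open>U\<close> is maximal.\<close>

section \<open>Ideals whose space \<open>ideal_space K I\<close> is complete\<close>

lemma ideal_on_subset: "ideal_on K I \<Longrightarrow> A \<in> I \<Longrightarrow> B \<subseteq> A \<Longrightarrow> B \<in> I"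
  unfolding ideal_on_def by blast

lemma decseq_positive_Inter_nonempty:
  assumes I: "ideal_on K I"
    and complete: "Metric_space.mcomplete (ideal_space K I) seq_dist"
    and B: "decseq B" "\<And>n. B n \<in> positive_sets K I"
  shows "(\<Inter>n. B n) \<noteq> {}"
proof -
  interpret Metric_space "ideal_space K I" seq_dist
    by (rule Metric_space_seq_dist)
  define \<sigma> where "\<sigma> = (\<lambda>i n. B (min n i))"
  have \<sigma>: "\<sigma> i \<in> ideal_space K I" for i
  proof -
    \<comment> \<open>The truncation \<open>\<sigma> i\<close> is constant with value
      \<open>B i\<close> from index \<open>i\<close> on, so the positive set \<open>B i\<close> lies
      below all its coordinates and witnesses both membership conditions.\<close>
    have Bi: "B i \<subseteq> \<sigma> i n" for n
      using B(1) unfolding \<sigma>_def decseq_def by simp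
    have Bpos: "B i \<notin> I" "B i \<subseteq> K"
      using B(2)[of i] by (auto simp: positive_sets_def)
    then have "B i \<noteq> {}"
      using I by (auto simp: ideal_on_def)
    then have "(\<Inter>n. \<sigma> i n) \<noteq> {}"
      using Bi by blast
    moreover have "K \<inter> (\<Inter>m<n. \<sigma> i m) \<notin> I" for n
      using ideal_on_subset[OF I, of "K \<inter> (\<Inter>m<n. \<sigma> i m)" "B i"] Bi Bpos by blast
    ultimately show ?thesis
      using B(2) by (simp add: ideal_space_def \<sigma>_def)
  qed
  have "MCauchy \<sigma>"
    unfolding MCauchy_def
  proof (intro conjI strip)
    show "range \<sigma> \<subseteq> ideal_space K I" using \<sigma> by blast
    fix e :: real assume "e > 0"
    then obtain n :: nat where n: "(1/2) ^ n < e" by (rule half_power_less)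
    have "seq_dist (\<sigma> i) (\<sigma> j) < e" if "n \<le> i" "n \<le> j" for i j
    proof -
      have "seq_dist (\<sigma> i) (\<sigma> j) < (1/2) ^ n"
        unfolding seq_dist_less_iff \<sigma>_def using that by (simp add: min_def)
      then show ?thesis using n by linarith
    qed
    then show "\<exists>N. \<forall>i j. N \<le> i \<longrightarrow> N \<le> j \<longrightarrow> seq_dist (\<sigma> i) (\<sigma> j) < e" by blast
  qed
  then obtain y where y: "limitin mtopology \<sigma> y sequentially"
    using complete unfolding mcomplete_def by blast
  then have y_mem: "y \<in> ideal_space K I"
    and lim: "\<And>e. e > 0 \<Longrightarrow> \<exists>N. \<forall>i\<ge>N. seq_dist (\<sigma> i) y < e"
    unfolding limit_metric_sequentially by blast+
  \<comment> \<open>Closeness to \<open>y\<close> within \<open>(1/2) ^ n\<close> means agreement up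
    to coordinate \<open>n\<close>, and \<open>\<sigma> i n = B n\<close> once \<open>i\<close> is
    at least \<open>n\<close>; hence the limit is \<open>B\<close> itself.\<close>
  have "y n = B n" for n
  proof -
    obtain N where N: "\<forall>i\<ge>N. seq_dist (\<sigma> i) y < (1/2) ^ n"
      using lim[of "(1/2) ^ n"] by auto
    then have "seq_dist (\<sigma> (max N n)) y < (1/2) ^ n" by simp
    then have "\<sigma> (max N n) n = y n" unfolding seq_dist_less_iff by blast
    then show ?thesis by (simp add: \<sigma>_def min_def split: if_splits)
  qed
  then show ?thesis using y_mem by (simp add: ideal_space_def)
qed

lemma positive_atom_exists:
  assumes I: "ideal_on K I" and "K \<notin> I"
    and complete: "Metric_space.mcomplete (ideal_space K I) seq_dist"
  shows "\<exists>A\<in>positive_sets K I. \<forall>B\<subseteq>A. B \<in> I \<or> A - B \<in> I"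
proof (rule ccontr)
  assume "\<not> ?thesis"
  then have "\<forall>A\<in>positive_sets K I. \<exists>B. B \<subseteq> A \<and> B \<notin> I \<and> A - B \<notin> I"
    by blast
  then obtain g where g: "\<And>A. A \<in> positive_sets K I \<Longrightarrow> g A \<subseteq> A \<and> g A \<notin> I \<and> A - g A \<notin> I"
    by metis
  \<comment> \<open>Each step discards the positive piece \<open>g A\<close> and keeps the positive
    rest \<open>A - g A\<close>.\<close>
  define C where "C = rec_nat K (\<lambda>_ A. A - g A)"
  have C_0: "C 0 = K" and C_Suc: "\<And>n. C (Suc n) = C n - g (C n)"
    by (simp_all add: C_def)
  have C_pos: "C n \<in> positive_sets K I" for n
  proof (induction n)
    case 0
    then show ?case using \<open>K \<notin> I\<close> by (simp add: C_0 positive_sets_def)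
  next
    case (Suc n)
    then show ?case using g[OF Suc] by (auto simp: C_Suc positive_sets_def)
  qed
  have "decseq C"
    by (rule decseq_SucI) (auto simp: C_Suc)
  define B where "B = (\<lambda>n. C n - (\<Inter>n. C n))"
  have "B n \<in> positive_sets K I" for n
  proof -
    \<comment> \<open>The piece discarded at step \<open>n\<close> misses \<open>C (Suc n)\<close>,
      hence also the total intersection, so it survives in \<open>B n\<close>.\<close>
    have "g (C n) \<inter> C (Suc n) = {}" using C_Suc by auto
    then have "g (C n) \<subseteq> B n" using g[OF C_pos[of n]] unfolding B_def by blast
    then have "B n \<notin> I" using g[OF C_pos[of n]] ideal_on_subset[OF I] by blast
    then show ?thesis using C_pos[of n] by (auto simp: B_def positive_sets_def)
  qed
  moreover have "decseq B"
    using \<open>decseq C\<close> unfolding B_def decseq_def by blast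
  ultimately have "(\<Inter>n. B n) \<noteq> {}"
    using decseq_positive_Inter_nonempty[OF I complete] by blast
  then show False by (auto simp: B_def)
qed

section \<open>Nowhere dense and meager sets in open subspaces\<close>

lemma nowhere_dense_in_subset:
  assumes "nowhere_dense_in X S" "T \<subseteq> S"
  shows "nowhere_dense_in X T"
  using assms interior_of_mono[OF closure_of_mono[OF assms(2), of X], of X]
  unfolding nowhere_dense_in_def by blast

text \<open>Closure and interior depend on the ambient space; a criterion in terms of open sets
  alone is easier to move between \<open>X\<close> and an open subspace.\<close>

lemma nowhere_dense_in_iff_open_subset:
  "nowhere_dense_in X S \<longleftrightarrow> S \<subseteq> topspace X \<and>
     (\<forall>W. openin X W \<and> W \<noteq> {} \<longrightarrow> (\<exists>W'\<subseteq>W. openin X W' \<and> W' \<noteq> {} \<and> W' \<inter> S = {}))"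
  (is "_ \<longleftrightarrow> _ \<and> ?R")
proof (intro iffI conjI)
  assume nd: "nowhere_dense_in X S"
  then show "S \<subseteq> topspace X" by (simp add: nowhere_dense_in_def)
  show ?R
  proof (intro strip)
    fix W assume W: "openin X W \<and> W \<noteq> {}"
    then have "\<not> W \<subseteq> X closure_of S"
      using nd interior_of_maximal[of W "X closure_of S" X] by (auto simp: nowhere_dense_in_def)
    moreover have "openin X (W - X closure_of S)"
      using W by (simp add: openin_diff)
    moreover have "S \<subseteq> X closure_of S"
      using nd by (simp add: nowhere_dense_in_def closure_of_subset)
    ultimately show "\<exists>W'\<subseteq>W. openin X W' \<and> W' \<noteq> {} \<and> W' \<inter> S = {}"
      by (intro exI[of _ "W - X closure_of S"]) blast
  qed
next
  assume R: "S \<subseteq> topspace X \<and> ?R"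
  have "X interior_of (X closure_of S) = {}"
  proof (rule ccontr)
    assume "X interior_of (X closure_of S) \<noteq> {}"
    then obtain W' where W': "W' \<subseteq> X interior_of (X closure_of S)" "openin X W'" "W' \<noteq> {}"
        "W' \<inter> S = {}"
      using R by (meson openin_interior_of)
    then have "W' \<inter> X closure_of S = {}"
      by (simp add: openin_Int_closure_of_eq_empty)
    then show False using W' interior_of_subset[of X "X closure_of S"] by blast
  qed
  then show "nowhere_dense_in X S" using R by (simp add: nowhere_dense_in_def)
qed

text \<open>The open sets of the subspace are exactly the open sets of \<open>X\<close> inside
  \<open>U\<close>. A test set of \<open>X\<close> that misses \<open>U\<close> already misses
  \<open>S\<close>; any other is replaced by its trace on \<open>U\<close>.\<close>

lemma nowhere_dense_in_open_subtopology_iff: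
  assumes "openin X U"
  shows "nowhere_dense_in (subtopology X U) S \<longleftrightarrow> S \<subseteq> U \<and> nowhere_dense_in X S"
proof (intro iffI conjI)
  have UX: "U \<subseteq> topspace X" using assms by (rule openin_subset)
  assume nd: "nowhere_dense_in (subtopology X U) S"
  then show SU: "S \<subseteq> U" by (simp add: nowhere_dense_in_def)
  show "nowhere_dense_in X S"
    unfolding nowhere_dense_in_iff_open_subset
  proof (intro conjI strip)
    show "S \<subseteq> topspace X" using SU UX by blast
    fix W assume W: "openin X W \<and> W \<noteq> {}"
    show "\<exists>W'\<subseteq>W. openin X W' \<and> W' \<noteq> {} \<and> W' \<inter> S = {}"
    proof (cases "W \<inter> U = {}")
      case True
      then show ?thesis using W SU by blast
    next
      case False
      then have "openin (subtopology X U) (W \<inter> U) \<and> W \<inter> U \<noteq> {}"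
        using W assms by (simp add: openin_open_subtopology openin_Int)
      then show ?thesis
        using nd assms unfolding nowhere_dense_in_iff_open_subset
        by (metis le_inf_iff openin_open_subtopology)
    qed
  qed
next
  assume S: "S \<subseteq> U \<and> nowhere_dense_in X S"
  show "nowhere_dense_in (subtopology X U) S"
    unfolding nowhere_dense_in_iff_open_subset
  proof (intro conjI strip)
    show "S \<subseteq> topspace (subtopology X U)"
      using S by (simp add: nowhere_dense_in_def)
    fix W assume "openin (subtopology X U) W \<and> W \<noteq> {}"
    then have W: "openin X W" "W \<noteq> {}" "W \<subseteq> U"
      using assms by (auto simp: openin_open_subtopology)
    then obtain W' where "W' \<subseteq> W" "openin X W'" "W' \<noteq> {}" "W' \<inter> S = {}"
      using S unfolding nowhere_dense_in_iff_open_subset by meson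
    then show "\<exists>W'\<subseteq>W. openin (subtopology X U) W' \<and> W' \<noteq> {} \<and> W' \<inter> S = {}"
      using assms W(3) by (intro exI[of _ W']) (simp add: openin_open_subtopology)
  qed
qed

lemma meager_in_open_subtopology_iff:
  assumes "openin X U"
  shows "meager_in (subtopology X U) S \<longleftrightarrow> S \<subseteq> U \<and> meager_in X S"
proof -
  have "(\<forall>n. N n \<subseteq> U \<and> nowhere_dense_in X (N n)) \<and> S = (\<Union>n. N n) \<longleftrightarrow>
      S \<subseteq> U \<and> (\<forall>n. nowhere_dense_in X (N n)) \<and> S = (\<Union>n. N n)" for N :: "nat \<Rightarrow> 'a set"
    by auto
  then show ?thesis
    unfolding meager_in_def nowhere_dense_in_open_subtopology_iff[OF assms] by simp
qed

lemma meager_in_subset: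
  assumes "meager_in X S" "T \<subseteq> S"
  shows "meager_in X T"
proof -
  obtain N where N: "\<And>n :: nat. nowhere_dense_in X (N n)" "S = (\<Union>n. N n)"
    using assms(1) unfolding meager_in_def by blast
  have "\<forall>n. nowhere_dense_in X (N n \<inter> T)"
    using nowhere_dense_in_subset[OF N(1)] by blast
  moreover have "T = (\<Union>n. N n \<inter> T)" using N(2) assms(2) by blast
  ultimately show ?thesis unfolding meager_in_def by (intro exI[of _ "\<lambda>n. N n \<inter> T"]) blast
qed

lemma meager_in_empty: "meager_in X {}"
  unfolding meager_in_def by (intro exI[of _ "\<lambda>_. {}"]) (simp add: nowhere_dense_in_def)

lemma meager_in_Un:
  assumes "meager_in X S" "meager_in X T"
  shows "meager_in X (S \<union> T)"
proof -
  obtain N M where N: "\<And>n :: nat. nowhere_dense_in X (N n)" "S = (\<Union>n. N n)"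
    and M: "\<And>n :: nat. nowhere_dense_in X (M n)" "T = (\<Union>n. M n)"
    using assms unfolding meager_in_def by blast
  \<comment> \<open>Interleaving: even indices enumerate the first sequence, odd indices the
    second.\<close>
  define L where "L = (\<lambda>n. if even n then N (n div 2) else M (n div 2))"
  have "L (2 * n) = N n" "L (Suc (2 * n)) = M n" for n by (simp_all add: L_def)
  then have "S \<union> T \<subseteq> (\<Union>n. L n)" unfolding N(2) M(2) by (metis UN_least UN_upper UNIV_I Un_least)
  moreover have "(\<Union>n. L n) \<subseteq> S \<union> T" unfolding N(2) M(2) L_def by auto
  moreover have "\<forall>n. nowhere_dense_in X (L n)" using N(1) M(1) by (simp add: L_def)
  ultimately show ?thesis unfolding meager_in_def by blast
qed

text \<open>The complements of the closures of the nowhere dense pieces are open and dense. Their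
  intersection is dense by the Baire property of the space, yet it misses \<open>U\<close>.\<close>

lemma Baire_space_open_meager_empty:
  assumes X: "Baire_space X" and U: "openin X U" "meager_in X U"
  shows "U = {}"
proof -
  obtain N where N: "\<And>n :: nat. nowhere_dense_in X (N n)" "U = (\<Union>n. N n)"
    using U(2) unfolding meager_in_def by blast
  define G where "G = (\<lambda>n. topspace X - X closure_of N n)"
  have "\<forall>n. openin X (G n) \<and> X closure_of (G n) = topspace X"
    using N(1) by (simp add: G_def nowhere_dense_in_def closure_of_complement openin_diff)
  then have dense: "X closure_of (\<Inter>n. G n) = topspace X"
    using X unfolding Baire_space_def by blast
  have "N n \<subseteq> X closure_of N n" for n
    using N(1) by (simp add: nowhere_dense_in_def closure_of_subset)
  then have "U \<inter> (\<Inter>n. G n) = {}" unfolding N(2) G_def by blast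
  then have "U \<inter> topspace X = {}"
    using openin_Int_closure_of_eq_empty[OF U(1), of "\<Inter>n. G n"] dense by simp
  then show ?thesis using openin_subset[OF U(1)] by blast
qed

section \<open>The K-ideal and its restriction to an open set\<close>

lemma ideal_on_K_ideal: "ideal_on K (K_ideal X K F)"
proof -
  have "B \<in> K_ideal X K F" if "A \<in> K_ideal X K F" "B \<subseteq> A" for A B
    using that meager_in_subset[of X "\<Union>\<alpha>\<in>A. F \<alpha>" "\<Union>\<alpha>\<in>B. F \<alpha>"] by (auto simp: K_ideal_def)
  moreover have "A \<union> B \<in> K_ideal X K F" if "A \<in> K_ideal X K F" "B \<in> K_ideal X K F" for A B
    using that by (simp add: K_ideal_def meager_in_Un)
  moreover have "K_ideal X K F \<subseteq> Pow K" "{} \<in> K_ideal X K F"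
    by (auto simp: K_ideal_def meager_in_empty)
  ultimately show ?thesis
    unfolding ideal_on_def by blast
qed

theorem theorem1:
  fixes X :: "'a topology" and k :: "'k rel" and F :: "'k \<Rightarrow> 'a set"
  assumes "Baire_space X"
    and "min_Kuratowski_card X k"
    and "Cinfinite k" and "regularCard k"
    and "inj_on F (Field k)" and "Kuratowski_partition X (F ` Field k)"
    and "Metric_space.mcomplete (ideal_space (Field k) (K_ideal X (Field k) F)) seq_dist"
  shows "\<exists>U. openin X U \<and>
    maximal_ideal_on (Field k) (K_ideal (subtopology X U) (Field k) (\<lambda>\<alpha>. F \<alpha> \<inter> U))"
proof -
  define K where "K = Field k"
  define I where "I = K_ideal X K F"
  have part: "partition_on (topspace X) (F ` K)"
    and BP: "\<And>\<F>'. \<F>' \<subseteq> F ` K \<Longrightarrow> Baire_property X (\<Union>\<F>')"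
    using assms(6) by (auto simp: Kuratowski_partition_def K_def)
  have cover: "(\<Union>\<alpha>\<in>K. F \<alpha>) = topspace X"
    using partition_onD1[OF part] by simp
  have disjoint: "F \<alpha> \<inter> F \<beta> = {}" if "\<alpha> \<in> K" "\<beta> \<in> K" "\<alpha> \<noteq> \<beta>" for \<alpha> \<beta>
    using that partition_onD2[OF part] inj_onD[OF assms(5), of \<alpha> \<beta>]
    by (auto simp: disjoint_def K_def)
  have "K \<noteq> {}"
    using assms(3) unfolding K_def cinfinite_def by auto
  \<comment> \<open>Blocks of a partition are nonempty, so one index already yields a point of
    \<open>X\<close>. The nonempty open set \<open>topspace X\<close> is then nonmeager, which makes
    \<open>I\<close> proper.\<close>
  then have "topspace X \<noteq> {}"
    unfolding cover[symmetric] using partition_onD3[OF part] by force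
  then have "K \<notin> I"
    using Baire_space_open_meager_empty[OF assms(1) openin_topspace] cover
    by (auto simp: I_def K_ideal_def)
  then obtain A where A: "A \<in> positive_sets K I" and atom: "\<And>B. B \<subseteq> A \<Longrightarrow> B \<in> I \<or> A - B \<in> I"
    using positive_atom_exists[of K I] assms(7) ideal_on_K_ideal unfolding I_def K_def by metis
  have AK: "A \<subseteq> K" and "A \<notin> I" using A by (auto simp: positive_sets_def)
  obtain U M where U: "openin X U" and M: "meager_in X M" and UM: "(\<Union>\<alpha>\<in>A. F \<alpha>) = sym_diff U M"
    using BP[of "F ` A"] AK unfolding Baire_property_def by blast
  \<comment> \<open>Otherwise the blocks indexed by \<open>A\<close> would have the meager union
    \<open>M\<close>, putting \<open>A\<close> into \<open>I\<close>.\<close>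
  have "U \<noteq> {}"
    using M UM \<open>A \<notin> I\<close> AK by (auto simp: I_def K_ideal_def)
  define J where "J = K_ideal (subtopology X U) K (\<lambda>\<alpha>. F \<alpha> \<inter> U)"
  have J_iff: "B \<in> J \<longleftrightarrow> B \<subseteq> K \<and> meager_in X ((\<Union>\<alpha>\<in>B. F \<alpha>) \<inter> U)" for B
    by (simp add: J_def K_ideal_def meager_in_open_subtopology_iff[OF U] Int_commute)
  have "K \<notin> J"
    using Baire_space_open_meager_empty[OF assms(1) U] \<open>U \<noteq> {}\<close> openin_subset[OF U]
    by (auto simp: J_iff cover Int_absorb1)
  \<comment> \<open>Only the part of \<open>B\<close> inside \<open>A\<close> matters on
    \<open>U\<close>: a block with index outside \<open>A\<close> is disjoint from the union over
    \<open>A\<close>, so its points in \<open>U\<close> lie in the meager error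
    \<open>M\<close>.\<close>
  moreover have B_in_J: "B \<in> J" if B: "B \<subseteq> K" "A \<inter> B \<in> I" for B
  proof -
    have "meager_in X ((\<Union>\<alpha>\<in>A \<inter> B. F \<alpha>) \<union> M)"
      using B(2) M by (simp add: I_def K_ideal_def meager_in_Un)
    moreover have "(\<Union>\<alpha>\<in>B. F \<alpha>) \<inter> U \<subseteq> (\<Union>\<alpha>\<in>A \<inter> B. F \<alpha>) \<union> M"
    proof
      fix x assume x: "x \<in> (\<Union>\<alpha>\<in>B. F \<alpha>) \<inter> U"
      then obtain \<beta> where \<beta>: "\<beta> \<in> B" "x \<in> F \<beta>" by blast
      show "x \<in> (\<Union>\<alpha>\<in>A \<inter> B. F \<alpha>) \<union> M"
      proof (cases "\<beta> \<in> A")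
        case False
        then have "x \<notin> (\<Union>\<alpha>\<in>A. F \<alpha>)" using \<beta> disjoint AK B(1) by blast
        then show ?thesis using UM x by blast
      qed (use \<beta> in blast)
    qed
    ultimately show ?thesis using B(1) meager_in_subset by (auto simp: J_iff)
  qed
  \<comment> \<open>Splitting the atom \<open>A\<close> along \<open>B\<close> leaves
    \<open>A \<inter> B\<close> or \<open>A \<inter> (K - B)\<close> in \<open>I\<close>, and
    \<open>B_in_J\<close> applies to the corresponding set.\<close>
  moreover have "B \<in> J \<or> K - B \<in> J" if "B \<subseteq> K" for B
  proof -
    have "A - A \<inter> B = A \<inter> (K - B)" using AK by blast
    then show ?thesis using atom[of "A \<inter> B"] B_in_J[of B] B_in_J[of "K - B"] that by auto
  qed
  ultimately have "maximal_ideal_on K J"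
    using ideal_on_K_ideal unfolding maximal_ideal_on_def J_def by blast
  then show ?thesis using U unfolding J_def K_def by blast
qed

end
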